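(* Let $\Gamma$ be a connected graph with countably infinitely many vertices such that for every vertex $\delta\in V\Gamma$ the graph $\Gamma\setminus\{\delta\}$ has at least two infinite connected components. Then $\Gamma$ is $2$-distinguishable.
   Context: Graphs are simple. $\Gamma$ is $2$-distinguishable if there is a coloring of $V\Gamma$ with at most $2$ colors such that no non-identity automorphism of $\Gamma$ preserves every color class setwise. *)

theory Defs
  imports "Graph_Theory.Graph_Theory" "HOL-Library.Countable_Set"
begin

(* A set of arcs has no multiplicities, so a simple graph, finite or infinite, is a loop-free
   pair digraph whose arc relation is symmetric: an edge {u,v} is the two arcs (u,v), (v,u).
   The locale pair_graph is not used because it also demands finiteness. *)
abbreviation simple_graph :: "'a pair_pre_digraph \<Rightarrow> bool" where
  "simple_graph G \<equiv> pair_bidirected_digraph G"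

definition conn_components :: "('a, 'b) pre_digraph \<Rightarrow> ('a, 'b) pre_digraph set" where
  "conn_components G = {H. pre_digraph.max_subgraph G Digraph_Component.connected H}"

lemma (in sym_digraph) conn_components_eq_sccs: "conn_components G = sccs"
proof -
  have sc: "strongly_connected H" if "induced_subgraph H G" "connected H" for H
    using that sym_arcs induced_graph_imp_symmetric
    by (metis induced_imp_subgraph subgraph_def wf_digraph.symmetric_connected_imp_strongly_connected)
  have con: "connected H" if "subgraph H G" "strongly_connected H" for H
    using that unfolding connected_conv strongly_connected_def reachable_def
    by (auto simp: symcl_def intro: rtrancl_on_mono)
  have mono: "arc_mono connected"
    unfolding arc_mono_def
    by (metis spanning_def subgraph_def wf_digraph.connected_spanning_imp_connected)
  have "max_subgraph connected H \<longleftrightarrow> max_subgraph strongly_connected H" for H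
  proof
    assume m: "max_subgraph connected H"
    then have "induced_subgraph H G" "connected H"
      using mono by (auto intro: induced_subgraphI_arc_mono max_subgraph_prop)
    then have "strongly_connected H" by (rule sc)
    then show "max_subgraph strongly_connected H"
      using m con by (auto simp: max_subgraph_def)
  next
    assume m: "max_subgraph strongly_connected H"
    then have sub: "subgraph H G" and s: "strongly_connected H"
      by (auto simp: max_subgraph_def)
    have False if H': "H' \<noteq> H" "subgraph H H'" "subgraph H' G" "connected H'" for H'
    proof -
      let ?K = "G \<restriction> verts H'"
      have K: "induced_subgraph ?K G" "subgraph H' ?K"
        using H' by (auto intro: induced_induce subgraph_induce_subgraphI2)
      have "connected ?K"
        using mono[unfolded arc_mono_def, rule_format, of H' ?K] H'(4) K(2) by simp
      then have "strongly_connected ?K" using K(1) sc by blast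
      moreover have "subgraph H ?K" "subgraph ?K G"
        using H'(2) K subgraph_trans by blast+
      ultimately have "?K = H" using m by (auto simp: max_subgraph_def)
      then have "subgraph H' H" using K(2) by simp
      then show False using H'(1,2)
        by (auto simp: subgraph_def compatible_def intro!: pre_digraph.equality)
    qed
    then show "max_subgraph connected H"
      using sub con[OF sub s] by (auto simp: max_subgraph_def)
  qed
  then show ?thesis by (auto simp: conn_components_def sccs_altdef2)
qed

(* Without parallel arcs an automorphism is determined by its vertex map, which is taken to be
   the automorphism here; its values outside the vertex set are irrelevant. *)
definition graph_automorphism :: "'a pair_pre_digraph \<Rightarrow> ('a \<Rightarrow> 'a) \<Rightarrow> bool" where
  "graph_automorphism G f \<longleftrightarrow>
     (\<exists>h. pre_digraph.digraph_isomorphism (with_proj G) h \<and>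
          app_iso h (with_proj G) = with_proj G \<and> iso_verts h = f)"

(* A colouring with at most n colours uses colours among 0, ..., n - 1, not necessarily all. *)
definition distinguishable :: "nat \<Rightarrow> 'a pair_pre_digraph \<Rightarrow> bool" where
  "distinguishable n G \<longleftrightarrow>
     (\<exists>c :: 'a \<Rightarrow> nat. (\<forall>v \<in> pverts G. c v < n) \<and>
        (\<forall>f. graph_automorphism G f \<and>
             (\<forall>i. f ` {v \<in> pverts G. c v = i} = {v \<in> pverts G. c v = i})
           \<longrightarrow> (\<forall>v \<in> pverts G. f v = v)))"

lemma graph_automorphism_iff:
  assumes "pair_wf_digraph G"
  shows "graph_automorphism G f \<longleftrightarrow>
    bij_betw f (pverts G) (pverts G) \<and>
    (\<forall>u \<in> pverts G. \<forall>v \<in> pverts G. (f u, f v) \<in> parcs G \<longleftrightarrow> (u, v) \<in> parcs G)"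
    (is "?L \<longleftrightarrow> ?R")
proof -
  interpret pair_wf_digraph G by (rule assms)
  have wf: "wf_digraph (with_proj G)" by unfold_locales
  show ?thesis
  proof
    assume ?L
    then obtain h where h: "pre_digraph.digraph_isomorphism (with_proj G) h"
      and app: "app_iso h (with_proj G) = with_proj G" and f: "iso_verts h = f"
      by (auto simp: graph_automorphism_def)
    from app have eqs: "f ` pverts G = pverts G" "iso_arcs h ` parcs G = parcs G"
      "iso_tail h = fst" "iso_head h = snd"
      by (auto simp: app_iso_def with_proj_def f)
    from h have inj: "inj_on f (pverts G)"
      and arcs: "\<And>a. a \<in> parcs G \<Longrightarrow> iso_arcs h a = (f (fst a), f (snd a))"
      by (auto simp: pre_digraph.digraph_isomorphism_def f eqs prod_eq_iff)
    have "(f u, f v) \<in> parcs G \<longleftrightarrow> (u, v) \<in> parcs G"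
      if uv: "u \<in> pverts G" "v \<in> pverts G" for u v
    proof
      assume "(f u, f v) \<in> parcs G"
      then obtain a where a: "a \<in> parcs G" "(f u, f v) = iso_arcs h a"
        using eqs(2) by blast
      then have "f (fst a) = f u" "f (snd a) = f v" using arcs by auto
      then have "fst a = u" "snd a = v"
        using inj uv a(1) arc_fst_in_verts arc_snd_in_verts by (auto dest: inj_onD)
      then show "(u, v) \<in> parcs G" using a(1) by auto
    next
      assume uv': "(u, v) \<in> parcs G"
      then have "iso_arcs h (u, v) \<in> parcs G" using eqs(2) by blast
      then show "(f u, f v) \<in> parcs G" using arcs[OF uv'] by simp
    qed
    then show ?R using inj eqs(1) by (auto simp: bij_betw_def)
  next
    assume R: ?R
    define h where "h = \<lparr>iso_verts = f, iso_arcs = map_prod f f,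
      iso_head = snd, iso_tail = (fst :: 'a \<times> 'a \<Rightarrow> 'a)\<rparr>"
    have inj: "inj_on f (pverts G)" and img: "f ` pverts G = pverts G"
      using R by (auto simp: bij_betw_def)
    have sub: "parcs G \<subseteq> pverts G \<times> pverts G"
      using in_arcsD1 in_arcsD2 by auto
    have inj2: "inj_on (map_prod f f) (parcs G)"
      using map_prod_inj_on[OF inj inj] sub by (rule inj_on_subset)
    have "map_prod f f ` parcs G = parcs G"
    proof
      show "map_prod f f ` parcs G \<subseteq> parcs G"
        using R in_arcsD1 in_arcsD2 by auto
    next
      show "parcs G \<subseteq> map_prod f f ` parcs G"
      proof
        fix a assume a: "a \<in> parcs G"
        then obtain x y where xy: "a = (x, y)" "x \<in> f ` pverts G" "y \<in> f ` pverts G"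
          using img sub by (cases a) auto
        then obtain u v where "u \<in> pverts G" "v \<in> pverts G" "x = f u" "y = f v" by blast
        then show "a \<in> map_prod f f ` parcs G"
          using a xy(1) R by (auto intro!: image_eqI[of _ _ "(u, v)"])
      qed
    qed
    then have "app_iso h (with_proj G) = with_proj G"
      by (simp add: h_def app_iso_def with_proj_def img)
    moreover have "pre_digraph.digraph_isomorphism (with_proj G) h"
      using wf inj inj2 by (auto simp: pre_digraph.digraph_isomorphism_def h_def)
    ultimately show ?L
      unfolding graph_automorphism_def by (intro exI[of _ h]) (simp add: h_def)
  qed
qed

end

theory Submission
  imports Defs
begin

text \<open>
  Fix a root \<open>w\<close> and grade the vertices by their distance from \<open>w\<close>. Every vertex \<open>v\<close> separates
  \<open>w\<close> from some component of the graph without \<open>v\<close>, and a vertex of that component closest to \<open>w\<close>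
  has \<open>v\<close> as its only neighbour one level below. Iterating, for every \<open>v\<close> there is on each level
  above \<open>v\<close> a vertex all of whose geodesics to \<open>w\<close> pass through \<open>v\<close>. Choose such a descendant
  \<open>b v\<close> for every one of the countably many \<open>v\<close>, on pairwise different and never consecutive levels
  \<open>\<ge> 3\<close>, and colour all \<open>b v\<close> together with \<open>w\<close> and one neighbour \<open>x\<close> of \<open>w\<close> black. The only
  adjacent black vertices are \<open>w\<close> and \<open>x\<close>, so a colour-preserving automorphism fixes or swaps them. A
  swap would move \<open>b x\<close> to the level just below its own, where there is no black vertex. So \<open>w\<close> is fixed, levels are preserved, every \<open>b v\<close> is fixed as the only black
  vertex of its level, and then so is \<open>v\<close>, as the only vertex of its level on a geodesic from
  \<open>w\<close> to \<open>b v\<close>.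
\<close>

section \<open>Graph distance in a symmetric relation\<close>

text \<open>On pairs that no walk joins, \<open>LEAST\<close> gives an unspecified number; inside
  the locale below any two vertices are joined.\<close>

definition gdist :: "'a rel \<Rightarrow> 'a \<Rightarrow> 'a \<Rightarrow> nat" where
  "gdist E u v = (LEAST n. (u, v) \<in> E ^^ n)"

lemma gdist_le: "(u, v) \<in> E ^^ n \<Longrightarrow> gdist E u v \<le> n"
  unfolding gdist_def by (rule Least_le)

lemma gdist_relpow: "(u, v) \<in> E\<^sup>* \<Longrightarrow> (u, v) \<in> E ^^ gdist E u v"
  unfolding gdist_def by (metis LeastI_ex rtrancl_imp_relpow)

lemma relpow_map:
  assumes "(u, v) \<in> E ^^ n" and "\<And>a b. (a, b) \<in> E \<Longrightarrow> (f a, f b) \<in> E"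
  shows "(f u, f v) \<in> E ^^ n"
  using assms(1) by (induction n arbitrary: v) (auto intro: assms(2))

locale connected_graph_relation =
  fixes V :: "'a set" and E :: "'a rel"
  assumes edges: "E \<subseteq> V \<times> V"
    and sym_edges: "sym E"
    and connected_vertices: "u \<in> V \<Longrightarrow> v \<in> V \<Longrightarrow> (u, v) \<in> E\<^sup>*"
begin

abbreviation d :: "'a \<Rightarrow> 'a \<Rightarrow> nat" where "d \<equiv> gdist E"

lemma d_relpow: "u \<in> V \<Longrightarrow> v \<in> V \<Longrightarrow> (u, v) \<in> E ^^ d u v"
  by (simp add: connected_vertices gdist_relpow)

lemma d_self [simp]: "d u u = 0"
  using gdist_le[of u u 0 E] by simp

lemma d_eq_0: "u \<in> V \<Longrightarrow> v \<in> V \<Longrightarrow> d u v = 0 \<longleftrightarrow> u = v"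
  using d_relpow[of u v] by auto

lemma d_triangle: "u \<in> V \<Longrightarrow> v \<in> V \<Longrightarrow> x \<in> V \<Longrightarrow> d u x \<le> d u v + d v x"
  by (meson d_relpow gdist_le relpow_trans)

lemma d_edge: "(u, v) \<in> E \<Longrightarrow> d u v \<le> 1"
  using gdist_le[of u v 1 E] by simp

lemma d_step: "w \<in> V \<Longrightarrow> (u, v) \<in> E \<Longrightarrow> d w v \<le> Suc (d w u)"
  using edges d_triangle[of w u v] d_edge[of u v] by fastforce

lemma d_step': "w \<in> V \<Longrightarrow> (u, v) \<in> E \<Longrightarrow> d w u \<le> Suc (d w v)"
  using d_step sym_edges by (meson symE)

lemma d_predecessor:
  assumes "u \<in> V" "v \<in> V" "d u v = Suc n"
  obtains t where "(t, v) \<in> E" "d u t = n"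
proof -
  obtain t where t: "(u, t) \<in> E ^^ n" "(t, v) \<in> E"
    using d_relpow[OF assms(1,2)] assms(3) by auto
  have "d u t \<le> n" using t(1) by (rule gdist_le)
  moreover have "Suc n \<le> Suc (d u t)"
    using d_step[OF assms(1) t(2)] assms(3) by simp
  ultimately show ?thesis using that t(2) by simp
qed

lemma d_map_le:
  assumes "\<And>a b. (a, b) \<in> E \<Longrightarrow> (f a, f b) \<in> E" "u \<in> V" "v \<in> V"
  shows "d (f u) (f v) \<le> d u v"
  using relpow_map[OF d_relpow[OF assms(2,3)]] assms(1) by (blast intro: gdist_le)

text \<open>Maps that preserve edges do not increase distances; this applies to \<open>f\<close> and
  to its inverse.\<close>

lemma d_automorphism:
  assumes f: "bij_betw f V V"
    and E: "\<And>u v. u \<in> V \<Longrightarrow> v \<in> V \<Longrightarrow> (f u, f v) \<in> E \<longleftrightarrow> (u, v) \<in> E"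
    and uv: "u \<in> V" "v \<in> V"
  shows "d (f u) (f v) = d u v"
proof (rule antisym)
  show "d (f u) (f v) \<le> d u v"
    using edges E uv by (intro d_map_le) auto
  let ?g = "inv_into V f"
  have g: "?g a \<in> V \<and> f (?g a) = a" if "a \<in> V" for a
    using f that by (metis bij_betw_imp_surj_on f_inv_into_f inv_into_into)
  have "(?g a, ?g b) \<in> E" if ab: "(a, b) \<in> E" for a b
  proof -
    have "a \<in> V" "b \<in> V" using ab edges by auto
    then show ?thesis using g E[of "?g a" "?g b"] ab by simp
  qed
  moreover have "f u \<in> V" "f v \<in> V" using f uv by (auto dest: bij_betwE)
  ultimately have "d (?g (f u)) (?g (f v)) \<le> d (f u) (f v)" by (intro d_map_le) auto
  then show "d u v \<le> d (f u) (f v)"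
    using f uv by (simp add: bij_betw_inv_into_left)
qed

section \<open>Unique parents and vertices that cut all geodesics\<close>

definition only_parent :: "'a \<Rightarrow> 'a \<Rightarrow> 'a \<Rightarrow> bool" where
  "only_parent w v u \<longleftrightarrow> (v, u) \<in> E \<and> d w u = Suc (d w v) \<and>
     (\<forall>t. (t, u) \<in> E \<and> d w u = Suc (d w t) \<longrightarrow> t = v)"

text \<open>The equation \<open>d w b = d w u + d u b\<close> says that \<open>u\<close> lies on a
  geodesic from \<open>w\<close> to \<open>b\<close>. So these geodesics all cross the level of
  \<open>v\<close> in \<open>v\<close> itself.\<close>

definition geodesic_cut :: "'a \<Rightarrow> 'a \<Rightarrow> 'a \<Rightarrow> bool" where
  "geodesic_cut w v b \<longleftrightarrow> d w b = d w v + d v b \<and>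
     (\<forall>u \<in> V. d w u = d w v \<and> d w b = d w u + d u b \<longrightarrow> u = v)"

lemma geodesic_cut_refl: "v \<in> V \<Longrightarrow> geodesic_cut w v v"
  using d_eq_0 by (auto simp: geodesic_cut_def)

text \<open>The last vertex before \<open>c\<close> on a geodesic from \<open>w\<close> is a parent
  of \<open>c\<close>, hence \<open>b\<close>. So a vertex on the level of \<open>v\<close> that
  lies on a geodesic to \<open>c\<close> already lies on one to \<open>b\<close>.\<close>

lemma geodesic_cut_step:
  assumes V: "w \<in> V" "v \<in> V" and cut: "geodesic_cut w v b" and par: "only_parent w b c"
  shows "geodesic_cut w v c"
proof -
  have bc: "(b, c) \<in> E" "d w c = Suc (d w b)"
    and only: "\<And>t. (t, c) \<in> E \<Longrightarrow> d w c = Suc (d w t) \<Longrightarrow> t = b"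
    using par by (auto simp: only_parent_def)
  have bV: "b \<in> V" and cV: "c \<in> V" using bc edges by auto
  have wb: "d w b = d w v + d v b" using cut by (simp add: geodesic_cut_def)
  have "d w c = d w v + d v c"
    using d_step[OF V(2) bc(1)] d_triangle[OF V cV] wb bc(2) by linarith
  moreover have "u = v"
    if u: "u \<in> V" "d w u = d w v" "d w c = d w u + d u c" for u
  proof -
    have "d u c = Suc (d v b)" using u wb bc(2) by simp
    then obtain t where t: "(t, c) \<in> E" "d u t = d v b"
      using d_predecessor[OF u(1) cV] by blast
    have tV: "t \<in> V" using t(1) edges by auto
    have "d w t \<le> d w b" using d_triangle[OF V(1) u(1) tV] u(2) t(2) wb by simp
    then have "d w c = Suc (d w t)" using d_step[OF V(1) t(1)] bc(2) by simp
    then have "t = b" using only t(1) by blast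
    then show ?thesis using cut u(1,2) t(2) wb by (auto simp: geodesic_cut_def)
  qed
  ultimately show ?thesis by (auto simp: geodesic_cut_def)
qed

lemma geodesic_cut_level:
  assumes "w \<in> V" "v \<in> V" and child: "\<And>v. v \<in> V \<Longrightarrow> \<exists>u. only_parent w v u"
    and "d w v \<le> n"
  shows "\<exists>b \<in> V. d w b = n \<and> geodesic_cut w v b"
  using assms(4)
proof (induction n rule: dec_induct)
  case base
  show ?case using assms(2) geodesic_cut_refl by blast
next
  case (step n)
  then obtain b where b: "b \<in> V" "d w b = n" "geodesic_cut w v b" by blast
  obtain c where c: "only_parent w b c" using child b(1) by blast
  then have "c \<in> V" "d w c = Suc n" using b(2) edges by (auto simp: only_parent_def)
  then show ?case using geodesic_cut_step[OF assms(1,2) b(3) c] by blast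
qed

text \<open>Since \<open>f\<close> keeps the distances to its fixed points \<open>w\<close> and
  \<open>b\<close>, also \<open>f v\<close> lies on a geodesic between them, on the level of
  \<open>v\<close>.\<close>

lemma geodesic_cut_automorphism:
  assumes f: "bij_betw f V V"
    and E: "\<And>u v. u \<in> V \<Longrightarrow> v \<in> V \<Longrightarrow> (f u, f v) \<in> E \<longleftrightarrow> (u, v) \<in> E"
    and V: "w \<in> V" "v \<in> V" "b \<in> V"
    and fw: "f w = w" and fb: "f b = b" and cut: "geodesic_cut w v b"
  shows "f v = v"
proof -
  have "f v \<in> V" using f V(2) by (auto dest: bij_betwE)
  moreover have "d w (f v) = d w v" "d (f v) b = d v b"
    using d_automorphism[OF f E] V fw fb by metis+
  ultimately show ?thesis using cut by (simp add: geodesic_cut_def)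
qed

section \<open>The black vertices\<close>

lemma distinguishing_set:
  assumes count: "countable V" and wV: "w \<in> V"
    and child: "\<And>v. v \<in> V \<Longrightarrow> \<exists>u. only_parent w v u"
  shows "\<exists>B \<subseteq> V. \<forall>f. bij_betw f V V \<longrightarrow>
    (\<forall>u \<in> V. \<forall>v \<in> V. (f u, f v) \<in> E \<longleftrightarrow> (u, v) \<in> E) \<longrightarrow> f ` B = B \<longrightarrow> (\<forall>v \<in> V. f v = v)"
proof -
  \<comment> \<open>The code is injective on \<open>V\<close> and at least \<open>d w v\<close>, so
    the level \<open>h v\<close> is not below \<open>v\<close>. The factor 2 rules out consecutive
    levels, and the offset 3 leaves level 2 free between \<open>x\<close> and all
    \<open>b v\<close>.\<close>
  define h where "h v = 3 + 2 * prod_encode (to_nat_on V v, d w v)" for v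
  have h_ge: "d w v \<le> h v" "3 \<le> h v" for v
    using le_prod_encode_2[of "d w v" "to_nat_on V v"] by (simp_all add: h_def)
  have h_apart: "u = v" if "u \<in> V" "v \<in> V" "h u \<le> Suc (h v)" "h v \<le> Suc (h u)" for u v
  proof -
    have "prod_encode (to_nat_on V u, d w u) = prod_encode (to_nat_on V v, d w v)"
      using that(3,4) unfolding h_def by presburger
    then show ?thesis using count that(1,2) by simp
  qed
  have "\<forall>v \<in> V. \<exists>b. b \<in> V \<and> d w b = h v \<and> geodesic_cut w v b"
    using geodesic_cut_level[OF wV _ child h_ge(1)] by blast
  then obtain b where b: "\<And>v. v \<in> V \<Longrightarrow> b v \<in> V \<and> d w (b v) = h v \<and> geodesic_cut w v (b v)"
    by metis
  obtain x where x: "only_parent w w x" using child wV by blast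
  then have wx: "(w, x) \<in> E" "d w x = 1" by (auto simp: only_parent_def)
  then have xV: "x \<in> V" and ne: "x \<noteq> w" using edges by auto
  define B where "B = {w, x} \<union> b ` V"
  have low: "p = w \<or> p = x" if "p \<in> B" "d w p < 3" for p
    using that h_ge(2) b unfolding B_def by (auto simp: not_less[symmetric])
  have sparse: "p = q" if pq: "p \<in> B" "q \<in> B" "3 \<le> d w p"
    "d w p \<le> Suc (d w q)" "d w q \<le> Suc (d w p)" for p q
  proof -
    obtain u where u: "u \<in> V" "p = b u" using pq(1,3) wx(2) by (auto simp: B_def)
    show ?thesis
    proof (cases "q \<in> {w, x}")
      case True
      then have "h u \<le> 2" using pq(4) u b wx(2) by auto
      then show ?thesis using h_ge(2)[of u] by simp
    next
      case False
      then obtain v where "v \<in> V" "q = b v" using pq(2) by (auto simp: B_def)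
      then show ?thesis using h_apart[of u v] pq(4,5) u b by auto
    qed
  qed
  have adjacent: "p \<in> {w, x} \<and> q \<in> {w, x}" if pq: "p \<in> B" "q \<in> B" "p \<noteq> q" "(p, q) \<in> E" for p q
  proof -
    have "d w p \<le> Suc (d w q)" "d w q \<le> Suc (d w p)"
      using d_step[OF wV pq(4)] d_step'[OF wV pq(4)] by auto
    then have "d w p < 3" "d w q < 3"
      using sparse[of p q] sparse[of q p] pq by (auto simp: not_less[symmetric])
    then show ?thesis using low pq(1,2) by blast
  qed
  have "f v = v"
    if f: "bij_betw f V V" and fE: "\<forall>u \<in> V. \<forall>v \<in> V. (f u, f v) \<in> E \<longleftrightarrow> (u, v) \<in> E"
      and fB: "f ` B = B" and v: "v \<in> V" for f v
  proof -
    have B: "B \<subseteq> V" "w \<in> B" "x \<in> B" "\<And>v. v \<in> V \<Longrightarrow> b v \<in> B"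
      using wV xV b by (auto simp: B_def)
    have dist: "d (f u) (f v) = d u v" if "u \<in> V" "v \<in> V" for u v
      using d_automorphism[OF f] fE that by blast
    have inj: "f u = f v \<longleftrightarrow> u = v" if "u \<in> V" "v \<in> V" for u v
      using f that by (auto simp: bij_betw_def inj_on_eq_iff)
    have "f w \<in> B" "f x \<in> B" "f w \<noteq> f x" "(f w, f x) \<in> E"
      using fB B inj[OF wV xV] ne fE wx(1) wV xV by auto
    then have pair: "f w \<in> {w, x}" "f x \<in> {w, x}" "f w \<noteq> f x" using adjacent by auto
    have fw: "f w = w"
    proof (rule ccontr)
      assume "f w \<noteq> w"
      then have swap: "f w = x" "f x = w" using pair by auto
      let ?b = "b x"
      have bV: "?b \<in> V" and bh: "3 \<le> d w ?b" and bx: "d w ?b = Suc (d x ?b)"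
        using b[OF xV] h_ge(2)[of x] wx(2) by (auto simp: geodesic_cut_def)
      have fb: "f ?b \<in> B" using fB B(4)[OF xV] by blast
      \<comment> \<open>As \<open>f x = w\<close>, the image of \<open>?b\<close> is as far from
        \<open>w\<close> as \<open>?b\<close> is from \<open>x\<close>, which is one less than the
        level of \<open>?b\<close>.\<close>
      have lev: "d w (f ?b) = d x ?b" using dist[OF xV bV] swap by simp
      have "?b = f ?b" using sparse[OF B(4)[OF xV] fb bh] lev bx by simp
      then show False using lev bx by simp
    qed
    have bV: "b v \<in> V" and bh: "3 \<le> d w (b v)" using b[OF v] h_ge(2) by auto
    have "f (b v) \<in> B" using fB B(4)[OF v] by blast
    moreover have "d w (f (b v)) = d w (b v)" using dist[OF wV bV] fw by simp
    ultimately have fb: "f (b v) = b v" using sparse[of "b v" "f (b v)"] B(4)[OF v] bh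
      by (metis le_SucI order_refl)
    show "f v = v"
      using geodesic_cut_automorphism[OF f _ wV v bV fw fb] fE b[OF v] by blast
  qed
  then have "\<forall>f. bij_betw f V V \<longrightarrow>
    (\<forall>u \<in> V. \<forall>v \<in> V. (f u, f v) \<in> E \<longleftrightarrow> (u, v) \<in> E) \<longrightarrow> f ` B = B \<longrightarrow> (\<forall>v \<in> V. f v = v)"
    by (intro allI impI ballI)
  moreover have "B \<subseteq> V" using wV xV b by (auto simp: B_def)
  ultimately show ?thesis by (intro exI[of _ B] conjI)
qed

section \<open>Unique parents from components\<close>

text \<open>Take \<open>u\<close> in \<open>C\<close> closest to \<open>w\<close>. A neighbour one
  level lower cannot be in \<open>C\<close>, so by \<open>closed\<close> it is \<open>v\<close>;
  there is one because \<open>u\<close> differs from \<open>w\<close>.\<close>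

lemma only_parent_exists:
  assumes wV: "w \<in> V" and C: "C \<noteq> {}" "C \<subseteq> V" "w \<notin> C"
    and closed: "\<And>u t. u \<in> C \<Longrightarrow> (t, u) \<in> E \<Longrightarrow> t \<noteq> v \<Longrightarrow> t \<in> C"
  shows "\<exists>u. only_parent w v u"
proof -
  obtain u where u: "u \<in> C" and min: "\<And>t. t \<in> C \<Longrightarrow> d w u \<le> d w t"
    using C(1) ex_has_least_nat[of "\<lambda>u. u \<in> C" _ "d w"] by blast
  have uV: "u \<in> V" "u \<noteq> w" using u C by auto
  have eq: "t = v" if "(t, u) \<in> E" "d w u = Suc (d w t)" for t
    using closed[OF u that(1)] min[of t] that(2) by force
  obtain n where n: "d w u = Suc n" using d_eq_0[OF wV uV(1)] uV(2) not0_implies_Suc by blast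
  obtain t where "(t, u) \<in> E" "d w t = n" using d_predecessor[OF wV uV(1) n] .
  then show ?thesis using eq n unfolding only_parent_def by metis
qed

end

text \<open>Deleting a vertex keeps the digraph symmetric, so its components are the strongly
  connected ones. The third claim provides \<open>closed\<close> above; the fourth serves to find a
  component that avoids the root.\<close>

lemma conn_components_del_vert:
  assumes "sym_digraph G"
    and C: "C \<in> conn_components (pre_digraph.del_vert G v)"
  shows "verts C \<noteq> {}" "verts C \<subseteq> verts G - {v}"
    and "u \<in> verts C \<Longrightarrow> (t, u) \<in> arcs_ends G \<Longrightarrow> t \<noteq> v \<Longrightarrow> t \<in> verts C"
    and "D \<in> conn_components (pre_digraph.del_vert G v) \<Longrightarrow> C \<noteq> D \<Longrightarrow> verts C \<inter> verts D = {}"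
proof -
  interpret G: sym_digraph G by (rule assms(1))
  let ?H = "pre_digraph.del_vert G v"
  have ends: "(a, b) \<in> arcs_ends ?H \<longleftrightarrow> (a, b) \<in> arcs_ends G \<and> a \<noteq> v \<and> b \<noteq> v" for a b
    by (auto simp: arcs_ends_conv G.del_vert_simps)
  have sym: "(b, a) \<in> arcs_ends G" if "(a, b) \<in> arcs_ends G" for a b
    using G.sym_arcs that by (rule arcs_ends_symmetric)
  interpret H: sym_digraph ?H
    using G.wf_digraph_del_vert sym
    by (auto simp: sym_digraph_def sym_digraph_axioms_def symmetric_def ends intro!: symI)
  note sccs = H.conn_components_eq_sccs
  have vC: "verts C \<in> H.sccs_verts" using C sccs H.in_sccs_vertsI_sccs by blast
  show "verts C \<noteq> {}" using vC by (simp add: H.in_sccs_verts_conv_reachable)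
  have ind: "induced_subgraph C ?H" using C sccs H.in_sccs_imp_induced by blast
  then show sub: "verts C \<subseteq> verts G - {v}"
    using G.del_vert_simps(1) by (metis induced_imp_subgraph subgraphE)
  show "t \<in> verts C" if u: "u \<in> verts C" and tu: "(t, u) \<in> arcs_ends G" "t \<noteq> v"
  proof -
    have "u \<noteq> v" using u sub by blast
    then have "(t, u) \<in> arcs_ends ?H" "(u, t) \<in> arcs_ends ?H" using tu sym ends by auto
    then have "t \<rightarrow>\<^sup>*\<^bsub>?H\<^esub> u" "u \<rightarrow>\<^sup>*\<^bsub>?H\<^esub> t" by (auto intro: H.reachable_adjI)
    then show ?thesis using vC u unfolding H.in_sccs_verts_conv_reachable by blast
  qed
  show "verts C \<inter> verts D = {}" if D: "D \<in> conn_components ?H" and "C \<noteq> D"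
  proof -
    have vD: "verts D \<in> H.sccs_verts" using D sccs H.in_sccs_vertsI_sccs by blast
    \<comment> \<open>Different components might a priori share their vertex set; strongly connected
      components are determined by it.\<close>
    have "verts C \<noteq> verts D"
      using H.inj_on_verts_sccs C D sccs \<open>C \<noteq> D\<close> by (metis inj_onD)
    then show ?thesis using H.sccs_verts_disjoint vC vD by blast
  qed
qed

theorem theorem8:
  fixes G :: "'a pair_pre_digraph"
  assumes "simple_graph G"
    and "Digraph_Component.connected (with_proj G)"
    and "infinite (pverts G)" and "countable (pverts G)"
    and "\<And>d. d \<in> pverts G \<Longrightarrow>
           \<exists>C \<in> conn_components (pre_digraph.del_vert (with_proj G) d).
           \<exists>D \<in> conn_components (pre_digraph.del_vert (with_proj G) d).
             C \<noteq> D \<and> infinite (verts C) \<and> infinite (verts D)"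
  shows "distinguishable 2 G"
proof -
  interpret pair_bidirected_digraph G by (rule assms(1))
  have wf: "pair_wf_digraph G" by unfold_locales
  have symG: "sym_digraph (with_proj G)" by unfold_locales
  have sc: "strongly_connected (with_proj G)"
    using assms(2) pair_sym_arcs symmetric_connected_imp_strongly_connected by blast
  interpret connected_graph_relation "pverts G" "parcs G"
  proof
    show "parcs G \<subseteq> pverts G \<times> pverts G" using in_arcsD1 in_arcsD2 by auto
    show "sym (parcs G)" using pair_sym_arcs by (simp add: symmetric_def)
    show "(u, v) \<in> (parcs G)\<^sup>*" if "u \<in> pverts G" "v \<in> pverts G" for u v
      using sc that reachable_rtranclI[of "with_proj G" u v] by (auto simp: strongly_connected_def)
  qed
  obtain w where w: "w \<in> pverts G" using assms(3) by fastforce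
  have "\<exists>u. only_parent w v u" if v: "v \<in> pverts G" for v
  proof -
    let ?K = "conn_components (pre_digraph.del_vert (with_proj G) v)"
    obtain C D where "C \<in> ?K" "D \<in> ?K" "C \<noteq> D" using assms(5)[OF v] by blast
    \<comment> \<open>By disjointness \<open>w\<close> lies in at most one of \<open>C\<close> and
      \<open>D\<close>, and for \<open>v = w\<close> in neither.\<close>
    then obtain K where K: "K \<in> ?K" "w \<notin> verts K"
      using conn_components_del_vert(4)[OF symG] by blast
    show ?thesis
    proof (rule only_parent_exists[OF w _ _ K(2)])
      show "verts K \<noteq> {}" using conn_components_del_vert(1)[OF symG K(1)] .
      show "verts K \<subseteq> pverts G" using conn_components_del_vert(2)[OF symG K(1)] by auto
      show "t \<in> verts K" if "u \<in> verts K" "(t, u) \<in> parcs G" "t \<noteq> v" for u t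
        using conn_components_del_vert(3)[OF symG K(1)] that by simp
    qed
  qed
  then obtain B where BV: "B \<subseteq> pverts G"
    and B: "\<And>f. \<lbrakk>bij_betw f (pverts G) (pverts G);
      \<forall>u \<in> pverts G. \<forall>v \<in> pverts G. (f u, f v) \<in> parcs G \<longleftrightarrow> (u, v) \<in> parcs G; f ` B = B\<rbrakk>
      \<Longrightarrow> \<forall>v \<in> pverts G. f v = v"
    using distinguishing_set[OF assms(4) w] by metis
  define c :: "'a \<Rightarrow> nat" where "c v = (if v \<in> B then 1 else 0)" for v
  \<comment> \<open>Colour 1 is black, so the case \<open>i = 1\<close> of colour preservation makes
    \<open>B\<close> invariant under \<open>f\<close>.\<close>
  have "{v \<in> pverts G. c v = 1} = B" using BV by (auto simp: c_def)
  then have "\<forall>v \<in> pverts G. f v = v"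
    if "graph_automorphism G f" "\<forall>i. f ` {v \<in> pverts G. c v = i} = {v \<in> pverts G. c v = i}" for f
    using that B[of f] unfolding graph_automorphism_iff[OF wf] by metis
  moreover have "\<forall>v \<in> pverts G. c v < 2" by (simp add: c_def)
  ultimately show ?thesis unfolding distinguishable_def by blast
qed

end
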